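(* Let $p,q>1$, $A>0$, $B>0$, $R\ge 1$, and let $f\in C_0^2(\mathbf{R})$, $g\in C_0^1(\mathbf{R})$ be real-valued functions with $\operatorname{supp} f,\ \operatorname{supp} g\subset\{x\in\mathbf{R}:|x|\le R\}$. Assume $$\int_{\mathbf{R}}g(x)\,dx>0.$$ Then there exist a positive constant $\varepsilon_3=\varepsilon_3(f,g,p,q,A,B,R)>0$ and a positive constant $C$ independent of $\varepsilon$ such that, for every $\varepsilon$ with $0<\varepsilon\le\varepsilon_3$, a classical solution on $\mathbf{R}\times[0,T]$ of the initial value problem $$u_{tt}-u_{xx}=A|u_t|^p+B|u|^q,\qquad u(x,0)=\varepsilon f(x),\quad u_t(x,0)=\varepsilon g(x)\quad(x\in\mathbf{R})$$ cannot exist whenever $T$ satisfies $$T\ge\begin{cases} C\,\varepsilon^{-(p-1)} & \text{for } p\le \dfrac{q+1}{2},\\[2mm] C\,\varepsilon^{-(q-1)/2} & \text{for } \dfrac{q+1}{2}\le p.\end{cases}$$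
   Context: Here $C_0^k(\mathbf{R})$ denotes the space of $k$ times continuously differentiable functions on $\mathbf{R}$ with compact support. A classical solution on $\mathbf{R}\times[0,T]$ is a real-valued function $u=u(x,t)$ of class $C^2$ on $\mathbf{R}\times[0,T]$ satisfying the equation there and the initial conditions at $t=0$. *)

theory Defs
  imports "HOL-Analysis.Analysis"
begin

definition supp :: "(real \<Rightarrow> real) \<Rightarrow> real set"
  where "supp f = closure {x. f x \<noteq> 0}"

definition C0 :: "nat \<Rightarrow> (real \<Rightarrow> real) set"
  where "C0 k = {f. (\<forall>j<k. (deriv ^^ j) f differentiable_on UNIV) \<and>
                    continuous_on UNIV ((deriv ^^ k) f) \<and> compact (supp f)}"

text \<open>
  A function \<open>u(x,t)\<close> on the strip \<open>\<real> \<times> [0,T]\<close>, where \<open>T > 0\<close>, is represented as a total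
  curried function whose values for \<open>t\<close> outside \<open>[0,T]\<close> are irrelevant. Time derivatives are
  therefore taken within \<open>[0,T]\<close>, i.e. they are one-sided at \<open>t = 0\<close> and \<open>t = T\<close>.
\<close>

definition partial_x :: "(real \<Rightarrow> real \<Rightarrow> real) \<Rightarrow> real \<Rightarrow> real \<Rightarrow> real"
  where "partial_x u x t = deriv (\<lambda>y. u y t) x"

definition partial_t :: "real \<Rightarrow> (real \<Rightarrow> real \<Rightarrow> real) \<Rightarrow> real \<Rightarrow> real \<Rightarrow> real"
  where "partial_t T u x t = vector_derivative (u x) (at t within {0..T})"

text \<open>
  Class \<open>C\<^sup>k\<close> on the strip: all partial derivatives of order at most \<open>k\<close>, the mixed ones in
  any order included, exist and are jointly continuous up to the boundary.
\<close>

primrec Ck_strip :: "real \<Rightarrow> nat \<Rightarrow> (real \<Rightarrow> real \<Rightarrow> real) \<Rightarrow> bool"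
  where
    "Ck_strip T 0 u \<longleftrightarrow> continuous_on (UNIV \<times> {0..T}) (\<lambda>(x, t). u x t)"
  | "Ck_strip T (Suc k) u \<longleftrightarrow>
       continuous_on (UNIV \<times> {0..T}) (\<lambda>(x, t). u x t) \<and>
       (\<forall>x. \<forall>t\<in>{0..T}. (\<lambda>y. u y t) differentiable (at x) \<and>
                       u x differentiable (at t within {0..T})) \<and>
       Ck_strip T k (partial_x u) \<and> Ck_strip T k (partial_t T u)"

definition classical_solution ::
    "real \<Rightarrow> real \<Rightarrow> real \<Rightarrow> real \<Rightarrow> (real \<Rightarrow> real) \<Rightarrow> (real \<Rightarrow> real) \<Rightarrow> real \<Rightarrow> real
      \<Rightarrow> (real \<Rightarrow> real \<Rightarrow> real) \<Rightarrow> bool"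
  where "classical_solution p q A B f g \<epsilon> T u \<longleftrightarrow>
    Ck_strip T 2 u \<and>
    (\<forall>x. \<forall>t\<in>{0..T}.
       partial_t T (partial_t T u) x t - partial_x (partial_x u) x t =
         A * \<bar>partial_t T u x t\<bar> powr p + B * \<bar>u x t\<bar> powr q) \<and>
    (\<forall>x. u x 0 = \<epsilon> * f x) \<and>
    (\<forall>x. partial_t T u x 0 = \<epsilon> * g x)"

end

(* The null derivatives u_t + u_x and u_t - u_x do not decrease in time along the lines
   x + t = const and x - t = const respectively, since there their derivative is the
   nonnegative right-hand side F.  In particular u_t + u_x >= 0 wherever x + t >= R.

   Bound from |u_t|^p: as the integral of g - f' is positive, some xi has (g - f')(xi) > 0.
   Along x = xi + t the function v = u_t - u_x starts at epsilon (g - f')(xi), and once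
   xi + 2t >= R we have u_t >= v/2, so dv/dt >= A (v/2)^p.

   Bound from |u|^q: in the cone |x| <= t - R d'Alembert's formula gives
   u >= (epsilon/2) (integral of g).  If u >= M for |x| <= t - R - sigma, then integrating F
   over a characteristic square of side delta in t - x and t + x yields
   u >= B M^q delta^2 / 4 for |x| <= t - R - sigma - delta.

   In both cases a lower bound M doubles after a delay D M^(-a), with a = p - 1 or
   a = (q - 1)/2.  The delays form a convergent geometric series, so the solution would be
   unbounded at a time of order epsilon^(-a). *)

theory Submission
  imports Defs
begin

section \<open>Increments of real functions and geometric doubling\<close>

lemma increment_ge:
  fixes \<phi> :: "real \<Rightarrow> real"
  assumes "a \<le> b"
    and deriv: "\<And>s. s \<in> {a..b} \<Longrightarrow> (\<phi> has_real_derivative \<phi>' s) (at s within {a..b})"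
    and bound: "\<And>s. s \<in> {a..b} \<Longrightarrow> K \<le> \<phi>' s"
  shows "\<phi> b - \<phi> a \<ge> K * (b - a)"
proof (cases "a = b")
  case False
  with \<open>a \<le> b\<close> have "a < b" by simp
  have "\<exists>s\<in>{a<..<b}. \<phi> b - \<phi> a = \<phi>' s * (b - a)"
    by (rule mvt_simple[OF \<open>a < b\<close>]) (use deriv in \<open>auto simp: has_field_derivative_def\<close>)
  then obtain s where s: "s \<in> {a<..<b}" "\<phi> b - \<phi> a = \<phi>' s * (b - a)"
    by blast
  then show ?thesis
    using bound[of s] \<open>a < b\<close> by (simp add: mult_right_mono)
qed simp

text \<open>The k-th doubling starts from 2^k M and so costs the delay D (2^k M)^(-a), which is D
  M^(-a) r^k with r = 2^(-a) < 1. All delays together stay below D M^(-a) / (1 - r), so a single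
  late \<open>\<sigma>\<close> serves every k; this is the common engine of both blow-up
  arguments.\<close>

lemma geometric_doubling:
  fixes P :: "real \<Rightarrow> real \<Rightarrow> bool" and a D \<tau> M \<sigma> :: real
  assumes "a > 0" "D > 0" "M > 0"
    and start: "P \<tau> M"
    and step: "\<And>\<sigma> N. \<sigma> \<ge> \<tau> \<Longrightarrow> N > 0 \<Longrightarrow> P \<sigma> N \<Longrightarrow> P (\<sigma> + D * N powr - a) (2 * N)"
    and mono: "\<And>\<sigma> \<sigma>' N. \<sigma> \<le> \<sigma>' \<Longrightarrow> P \<sigma> N \<Longrightarrow> P \<sigma>' N"
    and late: "\<sigma> \<ge> \<tau> + D * M powr - a / (1 - 2 powr - a)"
  shows "P \<sigma> (2 ^ k * M)"
proof -
  define r :: real where "r = 2 powr - a"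
  have r: "0 < r" "r < 1"
    using \<open>a > 0\<close> unfolding r_def by (simp_all add: powr_less_one)
  \<comment> \<open>Total delay of the first k doublings.\<close>
  define S where "S k = D * M powr - a * (\<Sum>j<k. r ^ j)" for k
  have S_nonneg: "S k \<ge> 0" for k
    unfolding S_def using \<open>D > 0\<close> r by (intro mult_nonneg_nonneg sum_nonneg) auto
  have S_le: "S k \<le> D * M powr - a / (1 - r)"
  proof -
    have "(\<Sum>j<k. r ^ j) = (1 - r ^ k) / (1 - r)"
      using r by (simp add: sum_gp_strict)
    also have "\<dots> \<le> 1 / (1 - r)"
      using r by (intro divide_right_mono) auto
    finally have "S k \<le> D * M powr - a * (1 / (1 - r))"
      unfolding S_def using \<open>D > 0\<close> by (intro mult_left_mono) auto
    then show ?thesis by simp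
  qed
  have "P (\<tau> + S k) (2 ^ k * M)"
  proof (induction k)
    case 0
    then show ?case using start by (simp add: S_def)
  next
    case (Suc k)
    have "(2 ^ k * M) powr - a = r ^ k * M powr - a"
      unfolding r_def using \<open>M > 0\<close>
      by (simp add: powr_mult powr_powr powr_realpow[symmetric] mult.commute)
    then have "S (Suc k) = S k + D * (2 ^ k * M) powr - a"
      by (simp add: S_def algebra_simps)
    then show ?case
      using step[OF _ _ Suc.IH] S_nonneg[of k] \<open>M > 0\<close> by (simp add: add.assoc mult.assoc)
  qed
  then show ?thesis
    using mono S_le late unfolding r_def by (meson add_left_mono order_trans)
qed

section \<open>Calculus on the strip up to its boundary\<close>

locale C2_strip =
  fixes T :: real and u :: "real \<Rightarrow> real \<Rightarrow> real"
  assumes T_pos: "T > 0" and C2: "Ck_strip T 2 u"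
begin

abbreviation "ux \<equiv> partial_x u"
abbreviation "ut \<equiv> partial_t T u"

lemma C1_derivatives: "Ck_strip T (Suc 0) ux" "Ck_strip T (Suc 0) ut"
  using C2 by (simp_all add: numeral_2_eq_2)

lemma C1: "Ck_strip T (Suc 0) u"
  using C2 by (simp add: numeral_2_eq_2)

end

lemma Ck_strip_partial_x:
  assumes "Ck_strip T (Suc k) h" "t \<in> {0..T}"
  shows "((\<lambda>y. h y t) has_real_derivative partial_x h x t) (at x)"
  using assms unfolding partial_x_def
  by (simp add: DERIV_deriv_iff_real_differentiable)

lemma Ck_strip_partial_t:
  assumes "T > 0" "Ck_strip T (Suc k) h" "t \<in> {0..T}"
  shows "(h x has_real_derivative partial_t T h x t) (at t within {0..T})"
proof -
  have "h x differentiable (at t within {0..T})"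
    using assms by simp
  then show ?thesis
    unfolding partial_t_def has_real_derivative_iff_has_vector_derivative
    by (simp add: vector_derivative_works)
qed

lemma strip_continuous_section:
  fixes h :: "real \<Rightarrow> real \<Rightarrow> real"
  assumes "continuous_on (UNIV \<times> {0..T}) (\<lambda>(x, t). h x t)" "I \<subseteq> {0..T}"
  shows "continuous_on I (h x)"
proof -
  have "continuous_on I (\<lambda>t. case (x, t) of (x, t) \<Rightarrow> h x t)"
    by (rule continuous_on_compose2[OF assms(1)]) (use assms(2) in \<open>auto intro!: continuous_intros\<close>)
  then show ?thesis by simp
qed

text \<open>Chain rule along a line of slope c. Since time derivatives are one-sided at t = 0 and t
  = T, the total derivative is taken within the closed strip.\<close>

lemma Ck_strip_along_line:
  assumes "T > 0" "Ck_strip T (Suc 0) h" "t \<in> {0..T}"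
  shows "((\<lambda>s. h (\<xi> + c * s) s) has_real_derivative
           (partial_t T h (\<xi> + c * t) t + c * partial_x h (\<xi> + c * t) t)) (at t within {0..T})"
proof -
  let ?x = "\<xi> + c * t"
  let ?D = "\<lambda>(a, b). partial_x h ?x t * a + blinfun_scaleR_left (partial_t T h ?x t) b"
  have ht: "continuous_on (UNIV \<times> {0..T}) (\<lambda>(x, t). partial_t T h x t)"
    using assms(2) by simp
  \<comment> \<open>Total differentiability needs the x-derivative at this one point, and a
    t-derivative on the strip that is continuous at the point.\<close>
  have "((\<lambda>(x, t). h x t) has_derivative ?D) (at (?x, t) within UNIV \<times> {0..T})"
  proof (rule has_derivative_partialsI)
    show "((\<lambda>x. h x t) has_derivative (*) (partial_x h ?x t)) (at ?x within UNIV)"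
      using Ck_strip_partial_x[OF assms(2,3)] by (simp add: has_field_derivative_def)
    show "(h x has_derivative blinfun_apply (blinfun_scaleR_left (partial_t T h x s)))
        (at s within {0..T})" if "s \<in> {0..T}" for x s
      using Ck_strip_partial_t[OF assms(1,2) that]
      by (simp add: has_field_derivative_def mult_commute_abs)
    have "continuous_on (UNIV \<times> {0..T}) (\<lambda>y. blinfun_scaleR_left (case y of (x, t) \<Rightarrow> partial_t T h x t))"
      by (intro continuous_intros ht)
    then show "continuous (at (?x, t) within UNIV \<times> {0..T})
        (\<lambda>(x, t). blinfun_scaleR_left (partial_t T h x t))"
      using assms(3) by (simp add: continuous_on_eq_continuous_within case_prod_unfold)
  qed (use assms in auto)
  moreover have "((\<lambda>s. (\<xi> + c * s, s)) has_derivative (\<lambda>d. (c * d, d))) (at t within {0..T})"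
    by (auto intro!: derivative_eq_intros)
  ultimately have "((\<lambda>(x, t). h x t) \<circ> (\<lambda>s. (\<xi> + c * s, s)) has_derivative ?D \<circ> (\<lambda>d. (c * d, d)))
      (at t within {0..T})"
    by (intro diff_chain_within) (auto intro: has_derivative_subset)
  then show ?thesis
    unfolding has_field_derivative_def
    by (rule has_derivative_eq_rhs[THEN has_derivative_transform_within, where d=1])
      (use assms in \<open>auto simp: o_def algebra_simps fun_eq_iff\<close>)
qed

context C2_strip
begin

text \<open>Valid at the boundary times too: integrating \<open>ut\<close> in time and
  differentiating under the integral in x writes \<open>ux\<close> as an integral of
  \<open>partial_x ut\<close> in time, which the fundamental theorem then differentiates.\<close>

lemma mixed_partials_eq:
  assumes "t \<in> {0..T}"
  shows "partial_t T ux x t = partial_x ut x t"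
proof -
  have cont_ut: "continuous_on (UNIV \<times> {0..T}) (\<lambda>(x, t). ut x t)"
    and cont_utx: "continuous_on (UNIV \<times> {0..T}) (\<lambda>(x, t). partial_x ut x t)"
    using C1_derivatives by simp_all
  have ux_eq: "ux x s = ux x 0 + integral {0..s} (partial_x ut x)" if s: "s \<in> {0..T}" for s
  proof -
    have "u y s = u y 0 + integral {0..s} (ut y)" for y
    proof -
      have "(ut y has_integral (u y s - u y 0)) {0..s}"
      proof (rule fundamental_theorem_of_calculus)
        show "(u y has_vector_derivative ut y r) (at r within {0..s})" if "r \<in> {0..s}" for r
          using Ck_strip_partial_t[OF T_pos C1, of r y] that s
          by (auto simp: has_real_derivative_iff_has_vector_derivative
              intro: has_vector_derivative_within_subset)
      qed (use s in auto)
      then show ?thesis by (simp add: integral_unique)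
    qed
    moreover have "((\<lambda>y. u y 0 + integral {0..s} (ut y)) has_real_derivative
        (ux x 0 + integral {0..s} (partial_x ut x))) (at x)"
    proof (intro DERIV_add Ck_strip_partial_x[OF C1])
      show "((\<lambda>y. integral {0..s} (ut y)) has_real_derivative
          integral {0..s} (partial_x ut x)) (at x)"
      proof (rule leibniz_rule_field_derivative[of UNIV 0 s, simplified])
        show "((\<lambda>y. ut y r) has_real_derivative partial_x ut y r) (at y)"
          if "0 \<le> r \<and> r \<le> s" for y r
          using that s by (intro Ck_strip_partial_x[OF C1_derivatives(2)]) auto
        show "ut y integrable_on {0..s}" for y
          using s by (intro integrable_continuous_real strip_continuous_section[OF cont_ut]) auto
        show "continuous_on (UNIV \<times> {0..s}) (\<lambda>(x, t). partial_x ut x t)"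
          by (rule continuous_on_subset[OF cont_utx]) (use s in auto)
      qed
    qed (use T_pos in auto)
    ultimately have "((\<lambda>y. u y s) has_real_derivative
        (ux x 0 + integral {0..s} (partial_x ut x))) (at x)"
      by presburger
    then show ?thesis
      using Ck_strip_partial_x[OF C1 s] DERIV_unique by blast
  qed
  have "((\<lambda>s. ux x 0 + integral {0..s} (partial_x ut x)) has_real_derivative partial_x ut x t)
      (at t within {0..T})"
    using DERIV_add[OF DERIV_const integral_has_real_derivative[OF
          strip_continuous_section[OF cont_utx order_refl] assms]]
    by simp
  then have "(ux x has_real_derivative partial_x ut x t) (at t within {0..T})"
    by (rule has_field_derivative_transform_within[where d=1]) (use assms ux_eq[symmetric] in simp_all)
  then have "(ux x has_vector_derivative partial_x ut x t) (at t within {0..T})"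
    by (simp add: has_real_derivative_iff_has_vector_derivative)
  then show ?thesis
    unfolding partial_t_def using T_pos assms
    by (auto intro!: vector_derivative_within_cbox[of 0 T, simplified])
qed

text \<open>The values c = 1 and c = -1 give the two null derivatives. Each is governed by the
  forcing along the lines x + c t = const, so \<open>null_deriv (- c)\<close> is followed along x =
  \<open>\<xi>\<close> + c t.\<close>

definition null_deriv :: "real \<Rightarrow> real \<Rightarrow> real \<Rightarrow> real"
  where "null_deriv c x t = ut x t + c * ux x t"

text \<open>The wave operator factors as (d_t + c d_x)(d_t - c d_x) when c^2 = 1, because the mixed
  derivatives cancel.\<close>

lemma null_deriv_along_characteristic:
  assumes "c\<^sup>2 = 1" "t \<in> {0..T}"
  shows "((\<lambda>s. null_deriv (- c) (\<xi> + c * s) s) has_real_derivative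
           (partial_t T ut (\<xi> + c * t) t - partial_x ux (\<xi> + c * t) t)) (at t within {0..T})"
proof -
  note lines = C1_derivatives[THEN Ck_strip_along_line[OF T_pos _ assms(2), of _ \<xi> c]]
  have c: "c * (c * y) = y" for y
    using assms(1) by (simp add: power2_eq_square flip: mult.assoc)
  show ?thesis
    unfolding null_deriv_def
    by (rule DERIV_cong[OF DERIV_add[OF lines(2) DERIV_cmult[OF lines(1)]]])
      (simp add: mixed_partials_eq[OF assms(2)] algebra_simps c)
qed

end

section \<open>Compactly supported initial data\<close>

text \<open>The mass of g is a Lebesgue integral over the line, whereas the calculus below works
  with \<open>integral\<close> over intervals.\<close>

lemma integral_Icc_eq_lborel:
  fixes g :: "real \<Rightarrow> real"
  assumes "continuous_on {a..b} g" and "\<And>x. x \<notin> {a..b} \<Longrightarrow> g x = 0"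
  shows "integral {a..b} g = (\<integral>x. g x \<partial>lborel)"
proof -
  have "(LINT x:{a..b}|lborel. g x) = (\<integral>x. g x \<partial>lborel)"
    unfolding set_lebesgue_integral_def
    by (rule Bochner_Integration.integral_cong) (use assms(2) in \<open>auto simp: indicator_def\<close>)
  then show ?thesis
    using set_borel_integral_eq_integral(2)[OF borel_integrable_atLeastAtMost'[OF assms(1)]]
    by simp
qed

text \<open>The vanishing includes the endpoints |x| = R and the derivative of f; it will be
  supplied with the radius of the theorem enlarged by 1.\<close>

locale compact_data =
  fixes f g :: "real \<Rightarrow> real" and R :: real
  assumes R_pos: "R > 0"
    and f_differentiable: "\<And>x. f differentiable (at x)"
    and deriv_f_continuous: "continuous_on UNIV (deriv f)"
    and g_continuous: "continuous_on UNIV g"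
    and outside: "\<And>x. \<bar>x\<bar> \<ge> R \<Longrightarrow> f x = 0 \<and> deriv f x = 0 \<and> g x = 0"
begin

lemma f_deriv: "(f has_real_derivative deriv f x) (at x within S)"
  using f_differentiable[of x]
  by (simp add: has_field_derivative_at_within DERIV_deriv_iff_real_differentiable)

lemma integral_g_Icc: "a \<le> - R \<Longrightarrow> b \<ge> R \<Longrightarrow> integral {a..b} g = (\<integral>x. g x \<partial>lborel)"
  by (rule integral_Icc_eq_lborel[OF continuous_on_subset[OF g_continuous]])
    (use outside in force)+

text \<open>Otherwise f minus the primitive of g would be nondecreasing on [-R, R], although it
  falls from 0 to minus the mass of g.\<close>

lemma ex_outgoing_positive:
  assumes "(\<integral>x. g x \<partial>lborel) > 0"
  shows "\<exists>x. \<bar>x\<bar> < R \<and> g x - deriv f x > 0"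
proof (rule ccontr)
  assume "\<not> ?thesis"
  then have neg: "g x - deriv f x \<le> 0" for x
    using outside[of x] by (cases "\<bar>x\<bar> < R") force+
  have "0 * (R - - R) \<le> (f R - integral {- R..R} g) - (f (- R) - integral {- R..- R} g)"
  proof (rule increment_ge)
    show "((\<lambda>y. f y - integral {- R..y} g) has_real_derivative deriv f x - g x) (at x within {- R..R})"
      if "x \<in> {- R..R}" for x
      by (intro DERIV_diff f_deriv integral_has_real_derivative
          continuous_on_subset[OF g_continuous] that) simp
  qed (use R_pos neg in \<open>auto simp: algebra_simps\<close>)
  then show False
    using assms integral_g_Icc[of "- R" R] outside[of R] outside[of "- R"] R_pos by simp
qed

end

section \<open>Monotonicity along characteristics and the bound in the cone\<close>

locale blowup_solution = compact_data f g R
  for f g R +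
  fixes p q A B \<epsilon> T :: real and u :: "real \<Rightarrow> real \<Rightarrow> real"
  assumes p_gt_1: "p > 1" and q_gt_1: "q > 1" and A_pos: "A > 0" and B_pos: "B > 0"
    and eps_pos: "\<epsilon> > 0" and time_pos: "T > 0"
    and solution: "classical_solution p q A B f g \<epsilon> T u"
    and mass_pos: "(\<integral>x. g x \<partial>lborel) > 0"
begin

sublocale C2_strip T u
  by unfold_locales (use time_pos solution in \<open>auto simp: classical_solution_def\<close>)

definition forcing :: "real \<Rightarrow> real \<Rightarrow> real"
  where "forcing x t = A * \<bar>ut x t\<bar> powr p + B * \<bar>u x t\<bar> powr q"

lemma forcing_ge:
  "forcing x t \<ge> 0" "forcing x t \<ge> A * \<bar>ut x t\<bar> powr p" "forcing x t \<ge> B * \<bar>u x t\<bar> powr q"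
  using A_pos B_pos by (simp_all add: forcing_def)

lemma initial:
  "u x 0 = \<epsilon> * f x" "null_deriv c x 0 = \<epsilon> * (g x + c * deriv f x)"
proof -
  have u0: "u x 0 = \<epsilon> * f x" "ut x 0 = \<epsilon> * g x" for x
    using solution by (auto simp: classical_solution_def)
  then have "ux x 0 = \<epsilon> * deriv f x"
    unfolding partial_x_def using deriv_cmult[of f x \<epsilon>] f_differentiable[of x]
    by (simp add: field_differentiable_def real_differentiable_def)
  with u0 show "u x 0 = \<epsilon> * f x" "null_deriv c x 0 = \<epsilon> * (g x + c * deriv f x)"
    by (simp_all add: null_deriv_def algebra_simps)
qed

lemma null_deriv_increment:
  assumes "c\<^sup>2 = 1" "0 \<le> a" "a \<le> b" "b \<le> T"
    and "\<And>s. s \<in> {a..b} \<Longrightarrow> K \<le> forcing (\<xi> + c * s) s"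
  shows "null_deriv (- c) (\<xi> + c * b) b - null_deriv (- c) (\<xi> + c * a) a \<ge> K * (b - a)"
proof (rule increment_ge)
  fix s assume s: "s \<in> {a..b}"
  have "((\<lambda>s. null_deriv (- c) (\<xi> + c * s) s) has_real_derivative
      (partial_t T ut (\<xi> + c * s) s - partial_x ux (\<xi> + c * s) s)) (at s within {a..b})"
    by (rule has_field_derivative_subset[OF null_deriv_along_characteristic]) (use assms s in auto)
  moreover have "partial_t T ut (\<xi> + c * s) s - partial_x ux (\<xi> + c * s) s = forcing (\<xi> + c * s) s"
    using solution s assms by (auto simp: classical_solution_def forcing_def)
  ultimately show "((\<lambda>s. null_deriv (- c) (\<xi> + c * s) s) has_real_derivative
      forcing (\<xi> + c * s) s) (at s within {a..b})"
    by simp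
qed (use assms in auto)

text \<open>The forcing is nonnegative, so the comparison is with the foot x + c t of the
  characteristic at time 0.\<close>

lemma null_deriv_ge_initial:
  assumes "c\<^sup>2 = 1" "t \<in> {0..T}"
  shows "null_deriv c x t \<ge> \<epsilon> * (g (x + c * t) + c * deriv f (x + c * t))"
  using null_deriv_increment[of "- c" 0 t 0 "x + c * t"] forcing_ge(1) assms initial(2)
  by (simp add: algebra_simps)

text \<open>Here the foot x + t lies where the data vanish.\<close>

lemma incoming_nonneg:
  assumes "t \<in> {0..T}" "x + t \<ge> R"
  shows "null_deriv 1 x t \<ge> 0"
  using null_deriv_ge_initial[of 1 t x] outside[of "x + t"] assms by simp

lemma u_increment:
  assumes "0 \<le> a" "a \<le> b" "b \<le> T"
    and "\<And>s. s \<in> {a..b} \<Longrightarrow> K \<le> null_deriv 1 (\<xi> + s) s"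
  shows "u (\<xi> + b) b - u (\<xi> + a) a \<ge> K * (b - a)"
proof (rule increment_ge)
  show "((\<lambda>s. u (\<xi> + s) s) has_real_derivative null_deriv 1 (\<xi> + s) s) (at s within {a..b})"
    if "s \<in> {a..b}" for s
    using has_field_derivative_subset[OF Ck_strip_along_line[OF T_pos C1, of s \<xi> 1], of "{a..b}"]
      that assms by (simp add: null_deriv_def)
qed (use assms in auto)

text \<open>Along x - t = const the solution grows at least as fast as the free wave with the same
  data. In the cone f vanishes at x - t and x + t, and the interval between them carries the whole
  mass of g.\<close>

lemma u_lower_bound_in_cone:
  assumes "t \<in> {0..T}" "\<bar>x\<bar> \<le> t - R"
  shows "u x t \<ge> \<epsilon> * ((\<integral>x. g x \<partial>lborel) / 2)"
proof -
  define \<xi> where "\<xi> = x - t"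
  \<comment> \<open>d'Alembert's formula at the point (\<open>\<xi> + s\<close>, s), without the
    term \<open>\<epsilon> / 2 * f \<xi>\<close>, which is constant in s.\<close>
  define \<phi> where "\<phi> s = \<epsilon> / 2 * (f (\<xi> + 2 * s) + integral {\<xi>..\<xi> + 2 * s} g)" for s
  have deriv: "((\<lambda>s. u (\<xi> + s) s - \<phi> s) has_real_derivative
      null_deriv 1 (\<xi> + s) s - \<epsilon> * (deriv f (\<xi> + 2 * s) + g (\<xi> + 2 * s))) (at s within {0..t})"
    if s: "s \<in> {0..t}" for s
  proof (rule DERIV_diff)
    show "((\<lambda>s. u (\<xi> + s) s) has_real_derivative null_deriv 1 (\<xi> + s) s) (at s within {0..t})"
      using has_field_derivative_subset[OF Ck_strip_along_line[OF T_pos C1, of s \<xi> 1], of "{0..t}"]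
        s assms by (simp add: null_deriv_def)
    have *: "((\<lambda>s. \<xi> + 2 * s) has_real_derivative 2) (at s within {0..t})"
      by (auto intro!: derivative_eq_intros)
    have "((\<lambda>y. integral {\<xi>..y} g) has_real_derivative g (\<xi> + 2 * s)) (at (\<xi> + 2 * s) within {\<xi>..\<xi> + 2 * t})"
      by (rule integral_has_real_derivative) (use s continuous_on_subset[OF g_continuous] in auto)
    then have "((\<lambda>y. f y + integral {\<xi>..y} g) has_real_derivative deriv f (\<xi> + 2 * s) + g (\<xi> + 2 * s))
        (at (\<xi> + 2 * s) within (\<lambda>s. \<xi> + 2 * s) ` {0..t})"
      by (intro DERIV_add f_deriv) (rule has_field_derivative_subset, auto)
    from DERIV_cmult[OF DERIV_image_chain[OF this *], of "\<epsilon> / 2"]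
    show "(\<phi> has_real_derivative \<epsilon> * (deriv f (\<xi> + 2 * s) + g (\<xi> + 2 * s))) (at s within {0..t})"
      by (simp add: \<phi>_def[abs_def] o_def algebra_simps)
  qed
  have "0 * (t - 0) \<le> (u (\<xi> + t) t - \<phi> t) - (u (\<xi> + 0) 0 - \<phi> 0)"
  proof (rule increment_ge[OF _ deriv])
    show "0 \<le> null_deriv 1 (\<xi> + s) s - \<epsilon> * (deriv f (\<xi> + 2 * s) + g (\<xi> + 2 * s))"
      if "s \<in> {0..t}" for s
      using null_deriv_ge_initial[of 1 s "\<xi> + s"] that assms by (simp add: algebra_simps)
  qed (use assms in auto)
  moreover have "f (x - t) = 0" "f (x + t) = 0"
    using outside[of "x - t"] outside[of "x + t"] assms by auto
  moreover have "integral {x - t..x + t} g = (\<integral>x. g x \<partial>lborel)"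
    by (rule integral_g_Icc) (use assms in auto)
  ultimately show ?thesis
    by (simp add: \<xi>_def \<phi>_def initial algebra_simps)
qed

section \<open>Upper bounds for the lifespan\<close>

lemma lifespan_power_of_ut:
  assumes \<xi>: "\<bar>\<xi>\<bar> < R" "g \<xi> - deriv f \<xi> > 0"
  shows "T < R + 2 powr p / A * (\<epsilon> * (g \<xi> - deriv f \<xi>)) powr - (p - 1) / (1 - 2 powr - (p - 1))"
proof (rule ccontr)
  define M where "M = \<epsilon> * (g \<xi> - deriv f \<xi>)"
  have M_pos: "M > 0" using eps_pos \<xi> by (simp add: M_def)
  \<comment> \<open>Vacuous for \<open>\<sigma> > T\<close>, so a doubling step may overshoot; at
    \<open>\<sigma> = T\<close> it still bounds the value at time T.\<close>
  define P where "P \<sigma> N \<longleftrightarrow> (\<forall>t. \<sigma> \<le> t \<and> t \<le> T \<longrightarrow> N \<le> null_deriv (- 1) (\<xi> + t) t)" for \<sigma> N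
  assume "\<not> ?thesis"
  then have late: "T \<ge> R + 2 powr p / A * M powr - (p - 1) / (1 - 2 powr - (p - 1))"
    by (simp add: M_def)
  have P: "P T (2 ^ k * M)" for k
  proof (rule geometric_doubling[where P = P, OF _ _ M_pos _ _ _ late])
    show "P R M"
      unfolding P_def M_def using null_deriv_ge_initial[of "- 1" t "\<xi> + t" for t] R_pos by simp
    show "P \<sigma>' N" if "\<sigma> \<le> \<sigma>'" "P \<sigma> N" for \<sigma> \<sigma>' N
      using that unfolding P_def by (meson order_trans)
    show "P (\<sigma> + 2 powr p / A * N powr - (p - 1)) (2 * N)" if "\<sigma> \<ge> R" "N > 0" "P \<sigma> N" for \<sigma> N
    proof -
      \<comment> \<open>The time in which growth at the rate A (N/2)^p adds N, as
        \<open>gain\<close> verifies.\<close>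
      define \<delta> where "\<delta> = 2 powr p / A * N powr - (p - 1)"
      have \<delta>_pos: "\<delta> > 0" using A_pos \<open>N > 0\<close> by (simp add: \<delta>_def)
      have gain: "A * (N / 2) powr p * \<delta> = N"
        using A_pos \<open>N > 0\<close> by (simp add: \<delta>_def powr_divide powr_diff powr_minus field_simps)
      have "2 * N \<le> null_deriv (- 1) (\<xi> + t) t" if t: "\<sigma> + \<delta> \<le> t" "t \<le> T" for t
      proof -
        have "A * (N / 2) powr p \<le> forcing (\<xi> + s) s" if s: "s \<in> {t - \<delta>..t}" for s
        proof -
          have "N \<le> null_deriv (- 1) (\<xi> + s) s"
            using \<open>P \<sigma> N\<close> s t unfolding P_def by auto
          moreover have "0 \<le> null_deriv 1 (\<xi> + s) s"
            by (rule incoming_nonneg) (use s t \<open>\<sigma> \<ge> R\<close> \<xi> R_pos in auto)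
          \<comment> \<open>The two null derivatives add up to 2 \<open>ut\<close>.\<close>
          ultimately have "N / 2 \<le> \<bar>ut (\<xi> + s) s\<bar>"
            by (simp add: null_deriv_def)
          then have "A * (N / 2) powr p \<le> A * \<bar>ut (\<xi> + s) s\<bar> powr p"
            using A_pos p_gt_1 \<open>N > 0\<close> by (intro mult_left_mono powr_mono2) auto
          then show ?thesis using forcing_ge(2) order_trans by blast
        qed
        then have "A * (N / 2) powr p * \<delta> \<le>
            null_deriv (- 1) (\<xi> + t) t - null_deriv (- 1) (\<xi> + (t - \<delta>)) (t - \<delta>)"
          using null_deriv_increment[of 1 "t - \<delta>" t _ \<xi>] t \<delta>_pos \<open>\<sigma> \<ge> R\<close> R_pos by simp
        moreover have "N \<le> null_deriv (- 1) (\<xi> + (t - \<delta>)) (t - \<delta>)"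
          using \<open>P \<sigma> N\<close> t \<delta>_pos unfolding P_def by auto
        ultimately show ?thesis using gain by simp
      qed
      then show ?thesis unfolding P_def \<delta>_def by auto
    qed
  qed (use A_pos p_gt_1 in auto)
  \<comment> \<open>At time T the null derivative is a fixed number, yet it would exceed every
    \<open>2 ^ k * M\<close>.\<close>
  obtain k where "null_deriv (- 1) (\<xi> + T) T / M < 2 ^ k"
    using real_arch_pow[of 2] by auto
  then show False
    using P[of k] M_pos unfolding P_def by (auto simp: field_simps)
qed

lemma lifespan_power_of_u:
  shows "T < R + sqrt (8 / B) * (\<epsilon> * ((\<integral>x. g x \<partial>lborel) / 2)) powr - ((q - 1) / 2)
              / (1 - 2 powr - ((q - 1) / 2))"
proof (rule ccontr)
  define M where "M = \<epsilon> * ((\<integral>x. g x \<partial>lborel) / 2)"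
  have M_pos: "M > 0" using eps_pos mass_pos by (simp add: M_def)
  \<comment> \<open>The shrinking triangle reduces to the single point (0, T) at
    \<open>\<sigma> = T - R\<close>, which is where the contradiction arises.\<close>
  define P where "P \<sigma> N \<longleftrightarrow> (\<forall>x t. t \<le> T \<and> \<bar>x\<bar> \<le> t - R - \<sigma> \<longrightarrow> N \<le> u x t)" for \<sigma> N
  assume "\<not> ?thesis"
  then have late: "T - R \<ge> 0 + sqrt (8 / B) * M powr - ((q - 1) / 2) / (1 - 2 powr - ((q - 1) / 2))"
    by (simp add: M_def)
  have P: "P (T - R) (2 ^ k * M)" for k
  proof (rule geometric_doubling[where P = P, OF _ _ M_pos _ _ _ late])
    show "P 0 M"
      unfolding P_def M_def using u_lower_bound_in_cone R_pos by auto
    show "P \<sigma>' N" if "\<sigma> \<le> \<sigma>'" "P \<sigma> N" for \<sigma> \<sigma>' N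
      using that unfolding P_def by auto
    show "P (\<sigma> + sqrt (8 / B) * N powr - ((q - 1) / 2)) (2 * N)" if "\<sigma> \<ge> 0" "N > 0" "P \<sigma> N" for \<sigma> N
    proof -
      \<comment> \<open>Chosen so that two integrations of B N^q, each over a time
        \<open>\<delta> / 2\<close>, yield exactly 2 N.\<close>
      define \<delta> where "\<delta> = sqrt (8 / B) * N powr - ((q - 1) / 2)"
      have \<delta>_pos: "\<delta> > 0" using B_pos \<open>N > 0\<close> by (simp add: \<delta>_def)
      have "\<delta>\<^sup>2 = 8 / B * N powr - (q - 1)"
        using B_pos \<open>N > 0\<close>
        by (simp add: \<delta>_def power_mult_distrib powr_power diff_divide_distrib)
      then have gain: "B * N powr q * (\<delta> / 2) * (\<delta> / 2) = 2 * N"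
        using B_pos \<open>N > 0\<close> by (simp add: powr_diff powr_minus field_simps power2_eq_square)
      have "2 * N \<le> u x t" if t: "t \<le> T" "\<bar>x\<bar> \<le> t - R - (\<sigma> + \<delta>)" for x t
      proof -
        have "B * N powr q * (\<delta> / 2) \<le> null_deriv 1 (x - t + s) s" if s: "s \<in> {t - \<delta> / 2..t}" for s
        proof -
          \<comment> \<open>The value of x + t on the incoming characteristic through the point (x -
            t + s, s). Going back by \<open>\<delta> / 2\<close> along it lowers t - x by at most
            \<open>\<delta>\<close>, and going back along the outgoing one does the same to t + x;
            hence the square stays in the triangle for \<open>\<sigma>\<close>.\<close>
          define \<eta> where "\<eta> = x - t + 2 * s"
          have "B * N powr q \<le> forcing (\<eta> - r) r" if r: "r \<in> {s - \<delta> / 2..s}" for r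
          proof -
            have "N \<le> u (\<eta> - r) r"
              using \<open>P \<sigma> N\<close> t s r unfolding P_def \<eta>_def by auto
            then have "B * N powr q \<le> B * \<bar>u (\<eta> - r) r\<bar> powr q"
              using B_pos q_gt_1 \<open>N > 0\<close> by (intro mult_left_mono powr_mono2) auto
            then show ?thesis using forcing_ge(3) order_trans by blast
          qed
          moreover have "0 \<le> s - \<delta> / 2" "s \<le> T"
            using t s \<open>\<sigma> \<ge> 0\<close> R_pos by auto
          ultimately have "B * N powr q * (\<delta> / 2) \<le>
              null_deriv 1 (\<eta> - s) s - null_deriv 1 (\<eta> - (s - \<delta> / 2)) (s - \<delta> / 2)"
            using null_deriv_increment[of "- 1" "s - \<delta> / 2" s "B * N powr q" \<eta>] \<delta>_pos
            by (simp add: algebra_simps)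
          moreover have "0 \<le> null_deriv 1 (\<eta> - (s - \<delta> / 2)) (s - \<delta> / 2)"
            by (rule incoming_nonneg) (use t s \<delta>_pos \<open>\<sigma> \<ge> 0\<close> R_pos in \<open>auto simp: \<eta>_def\<close>)
          moreover have "\<eta> - s = x - t + s" by (simp add: \<eta>_def)
          ultimately show ?thesis by simp
        qed
        then have "B * N powr q * (\<delta> / 2) * (t - (t - \<delta> / 2)) \<le>
            u (x - t + t) t - u (x - t + (t - \<delta> / 2)) (t - \<delta> / 2)"
          by (intro u_increment) (use t \<delta>_pos \<open>\<sigma> \<ge> 0\<close> R_pos in auto)
        \<comment> \<open>The increment alone is 2 N, so it is the positivity of this starting value
          that completes the bound.\<close>
        moreover have "N \<le> u (x - \<delta> / 2) (t - \<delta> / 2)"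
          using \<open>P \<sigma> N\<close> t \<delta>_pos unfolding P_def by auto
        ultimately show ?thesis using gain \<open>N > 0\<close> by simp
      qed
      then show ?thesis unfolding P_def \<delta>_def by auto
    qed
  qed (use B_pos q_gt_1 in auto)
  obtain k where "u 0 T / M < 2 ^ k"
    using real_arch_pow[of 2] by auto
  moreover have "2 ^ k * M \<le> u 0 T"
    using P[of k] unfolding P_def by auto
  ultimately show False
    using M_pos by (simp add: field_simps)
qed

end

section \<open>From the stated hypotheses to nonexistence\<close>

text \<open>With the radius enlarged by 1, every point with |x| >= R + 1 has a neighbourhood on
  which f vanishes, so its derivative vanishes there as well.\<close>

lemma C0_imp_compact_data:
  assumes "f \<in> C0 2" "g \<in> C0 1" "supp f \<subseteq> {x. \<bar>x\<bar> \<le> R}" "supp g \<subseteq> {x. \<bar>x\<bar> \<le> R}" "R \<ge> 0"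
  shows "compact_data f g (R + 1)"
proof
  have "(deriv ^^ 0) f differentiable_on UNIV" "(deriv ^^ 1) f differentiable_on UNIV"
      "(deriv ^^ 0) g differentiable_on UNIV"
    using assms(1,2) unfolding C0_def mem_Collect_eq
    by (meson pos2 one_less_numeral_iff semiring_norm(76) zero_less_one)+
  then have diff: "f differentiable_on UNIV" "deriv f differentiable_on UNIV" "g differentiable_on UNIV"
    by simp_all
  then show "\<And>x. f differentiable (at x)" "continuous_on UNIV (deriv f)" "continuous_on UNIV g"
    by (simp_all add: differentiable_imp_continuous_on differentiable_on_def)
  have zero: "f x = 0" "g x = 0" if "\<bar>x\<bar> > R" for x
    using subsetD[OF subset_trans[OF closure_subset assms(3)[unfolded supp_def]], of x]
      subsetD[OF subset_trans[OF closure_subset assms(4)[unfolded supp_def]], of x] that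
    by auto
  show "f x = 0 \<and> deriv f x = 0 \<and> g x = 0" if "\<bar>x\<bar> \<ge> R + 1" for x
  proof -
    have "open {x::real. \<bar>x\<bar> > R}"
      by (intro open_Collect_less continuous_intros)
    then have "(f has_real_derivative 0) (at x)"
      by (rule has_field_derivative_transform_within_open[OF DERIV_const[of 0]])
        (use that zero in auto)
    then show ?thesis
      using zero[of x] that by (simp add: DERIV_imp_deriv)
  qed
qed (use assms in auto)

text \<open>Both lifespan bounds hold for all p and q in question, so whichever lower bound on T
  applies contradicts one of them. The threshold 1 for \<open>\<epsilon>\<close> serves to absorb
  the additive radius into C.\<close>

theorem theorem2p3:
  fixes p q A B R :: real and f g :: "real \<Rightarrow> real"
  assumes "p > 1" and "q > 1" and "A > 0" and "B > 0" and "R \<ge> 1"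
    and "f \<in> C0 2" and "g \<in> C0 1"
    and "supp f \<subseteq> {x. \<bar>x\<bar> \<le> R}" and "supp g \<subseteq> {x. \<bar>x\<bar> \<le> R}"
    and "(\<integral>x. g x \<partial>lborel) > 0"
  shows "\<exists>\<epsilon>\<^sub>3>0. \<exists>C>0. \<forall>\<epsilon>. 0 < \<epsilon> \<and> \<epsilon> \<le> \<epsilon>\<^sub>3 \<longrightarrow>
    (\<forall>T. (p \<le> (q + 1) / 2 \<longrightarrow> T \<ge> C * \<epsilon> powr (- (p - 1))) \<and>
         ((q + 1) / 2 \<le> p \<longrightarrow> T \<ge> C * \<epsilon> powr (- ((q - 1) / 2)))
       \<longrightarrow> \<not> (\<exists>u. classical_solution p q A B f g \<epsilon> T u))"
proof -
  interpret compact_data f g "R + 1"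
    using C0_imp_compact_data assms by simp
  obtain \<xi> where \<xi>: "\<bar>\<xi>\<bar> < R + 1" "g \<xi> - deriv f \<xi> > 0"
    using ex_outgoing_positive assms by blast
  define m where "m = (\<integral>x. g x \<partial>lborel) / 2"
  \<comment> \<open>\<open>K\<^sub>1\<close> and \<open>K\<^sub>2\<close> are the coefficients left
    in the two lifespan bounds once the power of \<open>\<epsilon>\<close> is factored out.\<close>
  define K\<^sub>1 where "K\<^sub>1 = 2 powr p / A * (g \<xi> - deriv f \<xi>) powr - (p - 1) / (1 - 2 powr - (p - 1))"
  define K\<^sub>2 where "K\<^sub>2 = sqrt (8 / B) * m powr - ((q - 1) / 2) / (1 - 2 powr - ((q - 1) / 2))"
  have "2 powr - (p - 1) < 1" "2 powr - ((q - 1) / 2) < 1"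
    using assms by (auto intro!: powr_less_one)
  moreover have "m > 0"
    using assms by (simp add: m_def)
  ultimately have pos: "m > 0" "K\<^sub>1 > 0" "K\<^sub>2 > 0"
    unfolding K\<^sub>1_def K\<^sub>2_def using assms \<xi> by (auto intro!: divide_pos_pos mult_pos_pos)
  define C where "C = R + 1 + K\<^sub>1 + K\<^sub>2"
  have "\<not> classical_solution p q A B f g \<epsilon> T u"
    if \<epsilon>: "0 < \<epsilon>" "\<epsilon> \<le> 1" and T\<^sub>1: "p \<le> (q + 1) / 2 \<longrightarrow> T \<ge> C * \<epsilon> powr - (p - 1)"
      and T\<^sub>2: "(q + 1) / 2 \<le> p \<longrightarrow> T \<ge> C * \<epsilon> powr - ((q - 1) / 2)" for \<epsilon> T u
  proof
    assume sol: "classical_solution p q A B f g \<epsilon> T u"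
    \<comment> \<open>Since \<open>\<epsilon>\<close> is at most 1, its power with exponent -a is at
      least 1 and dominates the additive R + 1.\<close>
    have absorb: "C * \<epsilon> powr - a \<ge> R + 1 + K * \<epsilon> powr - a" if "a > 0" "K + (R + 1) \<le> C" for a K
    proof -
      have "\<epsilon> powr - a \<ge> 1"
        using \<epsilon> that by (simp add: powr_minus one_le_inverse powr_le1)
      then have "R + 1 \<le> (R + 1) * \<epsilon> powr - a"
        using \<open>R \<ge> 1\<close> by simp
      moreover have "(K + (R + 1)) * \<epsilon> powr - a \<le> C * \<epsilon> powr - a"
        using that by (intro mult_right_mono) auto
      ultimately show ?thesis by (simp add: algebra_simps)
    qed
    have T_ge: "T \<ge> R + 1 + K\<^sub>1 * \<epsilon> powr - (p - 1) \<or> T \<ge> R + 1 + K\<^sub>2 * \<epsilon> powr - ((q - 1) / 2)"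
      using absorb[of "p - 1" K\<^sub>1] absorb[of "(q - 1) / 2" K\<^sub>2] T\<^sub>1 T\<^sub>2 pos assms
      by (cases "p \<le> (q + 1) / 2") (auto simp: C_def)
    moreover have "0 \<le> K\<^sub>1 * \<epsilon> powr - (p - 1)" "0 \<le> K\<^sub>2 * \<epsilon> powr - ((q - 1) / 2)"
      using pos by auto
    \<comment> \<open>Positivity of T, which the strip calculus requires, comes from the assumed
      lower bound on T.\<close>
    ultimately have "T > 0" using \<open>R \<ge> 1\<close> by linarith
    interpret blowup_solution f g "R + 1" p q A B \<epsilon> T u
      by unfold_locales (use assms \<epsilon> \<open>T > 0\<close> sol in auto)
    have "T < R + 1 + K\<^sub>1 * \<epsilon> powr - (p - 1)"
      using lifespan_power_of_ut[OF \<xi>] \<epsilon> \<xi> by (simp add: K\<^sub>1_def powr_mult mult_ac)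
    moreover have "T < R + 1 + K\<^sub>2 * \<epsilon> powr - ((q - 1) / 2)"
      using lifespan_power_of_u[folded m_def] \<epsilon> pos by (simp add: K\<^sub>2_def powr_mult mult_ac)
    ultimately show False using T_ge by linarith
  qed
  moreover have "C > 0" using pos \<open>R \<ge> 1\<close> by (simp add: C_def)
  ultimately show ?thesis
    by (intro exI[of _ 1] conjI exI[of _ C]) auto
qed

end
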